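(* For every graph $G$, $c_{\max}(G)\le \mathrm{tw}(G)+1$, where $c_{\max}(G)$ is the maximum cop number $c(\mathcal{G})$ over all periodic graphs $\mathcal{G}$ with footprint $G$.
   Context: All graphs are finite, undirected and reflexive. A periodic graph with period $p\ge1$ is a sequence $\mathcal{G}=(G_0,\dots,G_{p-1})$ of graphs $G_i=(V,E_i)$ on a common vertex set, extended by $G_{i+p}=G_i$; its footprint is $(V,\bigcup_iE_i)$. Periodic graphs are assumed temporally connected (equivalently, the footprint is connected). Cops and Robber on $\mathcal{G}$ with $k$ cops (perfect information): cops choose starting vertices, then the robber; in each round $t=0,1,\dots$ each cop moves to a vertex of $N_{G_{t\bmod p}}[\text{its position}]$, then the robber likewise; the cops win if a cop ever moves onto the robber's vertex. The cop number $c(\mathcal{G})$ is the least $k$ such that $k$ cops have a winning strategy. $\mathrm{tw}(G)$ is the treewidth of $G$: the minimum over tree decompositions $(T,\{B_x\})$ of $G$ of $\max_x|B_x|-1$. *)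

theory Defs
  imports "Graph_Theory.Graph_Theory" "HOL-Library.Extended_Nat"
begin

text \<open>
  Undirected graphs are symmetric digraphs whose arcs are pairs of vertices.  As usual, graphs are
  non-empty.
\<close>

locale refl_graph = pair_pseudo_graph G for G :: "'a pair_pre_digraph" +
  assumes nonempty: "pverts G \<noteq> {}"
    and reflexive: "v \<in> pverts G \<Longrightarrow> (v, v) \<in> parcs G"

definition closed_nbhd :: "'a pair_pre_digraph \<Rightarrow> 'a \<Rightarrow> 'a set" where
  "closed_nbhd G v = insert v {w. (v, w) \<in> parcs G}"

text \<open>
  A periodic graph is the list of its snapshots over one period; its period is the length of the
  list.
\<close>

definition snapshot :: "'a pair_pre_digraph list \<Rightarrow> nat \<Rightarrow> 'a pair_pre_digraph" where
  "snapshot \<G> t = \<G> ! (t mod length \<G>)"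

definition footprint :: "'a pair_pre_digraph list \<Rightarrow> 'a pair_pre_digraph" where
  "footprint \<G> = \<lparr>pverts = (\<Union>G \<in> set \<G>. pverts G), parcs = (\<Union>G \<in> set \<G>. parcs G)\<rparr>"

text \<open>
  Temporal connectedness is expressed by connectedness of the footprint.  The two are equivalent
  because every snapshot recurs and waiting is allowed.
\<close>

definition periodic_graph :: "'a pair_pre_digraph list \<Rightarrow> bool" where
  "periodic_graph \<G> \<longleftrightarrow> \<G> \<noteq> [] \<and> (\<forall>G \<in> set \<G>. refl_graph G)
     \<and> (\<exists>V. \<forall>G \<in> set \<G>. pverts G = V) \<and> connected (with_proj (footprint \<G>))"

text \<open>
  In a play, \<open>r t\<close> is the position of the robber at the beginning of round \<open>t\<close>, so \<open>r 0\<close> is his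
  starting vertex and \<open>r (Suc t)\<close> is the vertex to which he moves in round \<open>t\<close>.
\<close>

definition robber_play :: "'a pair_pre_digraph list \<Rightarrow> (nat \<Rightarrow> 'a) \<Rightarrow> bool" where
  "robber_play \<G> r \<longleftrightarrow> r 0 \<in> pverts (footprint \<G>)
     \<and> (\<forall>t. r (Suc t) \<in> closed_nbhd (snapshot \<G> t) (r t))"

text \<open>
  A strategy \<open>\<sigma>\<close> for \<open>k\<close> cops maps the list of the robber's positions so far to the positions of
  cops \<open>0, \<dots>, k - 1\<close>: \<open>\<sigma> []\<close> is the initial placement, and \<open>\<sigma> [r 0, \<dots>, r t]\<close> is the placement
  after the cops' move in round \<open>t\<close>.  The earlier positions of the cops and the round number are
  determined by \<open>\<sigma>\<close> and this list, so this is the general form of a strategy under perfect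
  information.  A cop that does not leave its vertex counts as moving onto that vertex; hence a
  robber who moves (or starts) on the vertex of a cop is caught in the next move of the cops.
\<close>

definition cop_strategy ::
  "'a pair_pre_digraph list \<Rightarrow> nat \<Rightarrow> ('a list \<Rightarrow> nat \<Rightarrow> 'a) \<Rightarrow> bool" where
  "cop_strategy \<G> k \<sigma> \<longleftrightarrow> (\<forall>i<k. \<sigma> [] i \<in> pverts (footprint \<G>))
     \<and> (\<forall>r. robber_play \<G> r \<longrightarrow> (\<forall>t. \<forall>i<k.
          \<sigma> (map r [0..<Suc t]) i \<in> closed_nbhd (snapshot \<G> t) (\<sigma> (map r [0..<t]) i)))"

definition winning_cop_strategy ::
  "'a pair_pre_digraph list \<Rightarrow> nat \<Rightarrow> ('a list \<Rightarrow> nat \<Rightarrow> 'a) \<Rightarrow> bool" where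
  "winning_cop_strategy \<G> k \<sigma> \<longleftrightarrow> cop_strategy \<G> k \<sigma>
     \<and> (\<forall>r. robber_play \<G> r \<longrightarrow> (\<exists>t. \<exists>i<k. \<sigma> (map r [0..<Suc t]) i = r t))"

definition cop_number :: "'a pair_pre_digraph list \<Rightarrow> nat" where
  "cop_number \<G> = (LEAST k. \<exists>\<sigma>. winning_cop_strategy \<G> k \<sigma>)"

text \<open>
  The cop numbers of the periodic graphs with footprint \<open>G\<close> are bounded by the number of vertices
  of \<open>G\<close>, so for connected \<open>G\<close> the following supremum is a maximum.  No periodic graph has a
  disconnected footprint, and for disconnected \<open>G\<close> the supremum is \<open>0\<close>.
\<close>

definition c_max :: "'a pair_pre_digraph \<Rightarrow> enat" where
  "c_max G = (SUP \<G> \<in> {\<G>. periodic_graph \<G> \<and> footprint \<G> = G}. enat (cop_number \<G>))"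

text \<open>
  In a symmetric digraph, going along an edge and back is a cycle, so only cycles of length at
  least three are excluded.  For the same reason \<^const>\<open>tree\<close> cannot be used here: it excludes
  all directed cycles, hence every symmetric digraph with an edge.
\<close>

definition is_tree :: "'b pair_pre_digraph \<Rightarrow> bool" where
  "is_tree T \<longleftrightarrow> pair_graph T \<and> connected (with_proj T)
     \<and> (\<forall>p. pre_digraph.cycle (with_proj T) p \<longrightarrow> length p < 3)"

definition tree_decomposition ::
  "'a pair_pre_digraph \<Rightarrow> 'b pair_pre_digraph \<Rightarrow> ('b \<Rightarrow> 'a set) \<Rightarrow> bool" where
  "tree_decomposition G T B \<longleftrightarrow> is_tree T
     \<and> (\<Union>x \<in> pverts T. B x) = pverts G
     \<and> (\<forall>(u, v) \<in> parcs G. \<exists>x \<in> pverts T. u \<in> B x \<and> v \<in> B x)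
     \<and> (\<forall>v \<in> pverts G. connected (with_proj T \<restriction> {x \<in> pverts T. v \<in> B x}))"

definition width :: "'b pair_pre_digraph \<Rightarrow> ('b \<Rightarrow> 'a set) \<Rightarrow> nat" where
  "width T B = (MAX x \<in> pverts T. card (B x)) - 1"

text \<open>
  Trees are finite, so it is no restriction to take natural numbers as their nodes.
\<close>

definition treewidth :: "'a pair_pre_digraph \<Rightarrow> nat" where
  "treewidth G = (LEAST w. \<exists>(T :: nat pair_pre_digraph) B. tree_decomposition G T B \<and> w = width T B)"

end

theory Submission
  imports Defs
begin

text \<open>
  The cops occupy all of a bag \<open>B x\<close>, so the robber is confined to the bags of one branch of the
  tree at \<open>x\<close>, hanging from a neighbour \<open>y\<close> of \<open>x\<close>.  The cops on \<open>B x \<inter> B y\<close> stay, which keeps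
  the robber in that branch because \<open>B x \<inter> B y\<close> separates it from the rest of the graph.  Meanwhile
  the other cops travel one by one to \<open>B y - B x\<close>; there are enough of them because \<open>B y\<close> has at
  most as many vertices as there are cops, and they arrive because every edge of the connected
  footprint recurs.  Now the branch that contains the robber is strictly smaller.
\<close>

section \<open>Winning positions\<close>

text \<open>The cops are to move in round \<open>t\<close>.  Captures by moving onto the robber are not recorded as
  wins: the strategy wins already by letting the robber run into a standing cop.\<close>

inductive cops_win :: "'a pair_pre_digraph list \<Rightarrow> nat \<Rightarrow> nat \<Rightarrow> (nat \<Rightarrow> 'a) \<Rightarrow> 'a \<Rightarrow> bool"
  for \<G> k where
  capture: "i < k \<Longrightarrow> c i = r \<Longrightarrow> cops_win \<G> k t c r"
| move: "(\<And>i. i < k \<Longrightarrow> c' i \<in> closed_nbhd (snapshot \<G> t) (c i)) \<Longrightarrow>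
    (\<And>r'. r' \<in> closed_nbhd (snapshot \<G> t) r \<Longrightarrow> cops_win \<G> k (Suc t) c' r') \<Longrightarrow>
    cops_win \<G> k t c r"

text \<open>The history given to \<open>\<sigma>\<close> starts at round \<open>t\<close>:
  \<open>\<sigma> []\<close> is the present placement, and entry \<open>s\<close> is the robber's
  position at the beginning of round \<open>t + s\<close>.\<close>

definition wins_from ::
  "'a pair_pre_digraph list \<Rightarrow> nat \<Rightarrow> nat \<Rightarrow> (nat \<Rightarrow> 'a) \<Rightarrow> 'a \<Rightarrow> ('a list \<Rightarrow> nat \<Rightarrow> 'a) \<Rightarrow> bool" where
  "wins_from \<G> k t c r \<sigma> \<longleftrightarrow> \<sigma> [] = c
     \<and> (\<forall>\<rho>. \<rho> 0 = r \<and> (\<forall>s. \<rho> (Suc s) \<in> closed_nbhd (snapshot \<G> (t + s)) (\<rho> s)) \<longrightarrow>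
          (\<forall>s. \<forall>i<k. \<sigma> (map \<rho> [0..<Suc s]) i
             \<in> closed_nbhd (snapshot \<G> (t + s)) (\<sigma> (map \<rho> [0..<s]) i))
          \<and> (\<exists>s. \<exists>i<k. \<sigma> (map \<rho> [0..<Suc s]) i = \<rho> s))"

text \<open>After a \<open>move\<close>, the rest of a play is a play from the position that the
  robber's reply creates, with the first entry of the history cut off. So the strategies for the
  possible replies can be glued.\<close>

lemma cops_win_imp_wins_from:
  assumes "cops_win \<G> k t c r"
  shows "\<exists>\<sigma>. wins_from \<G> k t c r \<sigma>"
  using assms
proof induction
  case (capture i c r t)
  then have "wins_from \<G> k t c r (\<lambda>_. c)"
    unfolding wins_from_def by (metis closed_nbhd_def insertI1)
  then show ?case by (intro exI)
next
  case (move c' t c r)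
  let ?N = "closed_nbhd (snapshot \<G> t) r"
  from move.IH obtain \<tau> where \<tau>: "\<And>r'. r' \<in> ?N \<Longrightarrow> wins_from \<G> k (Suc t) c' r' (\<tau> r')"
    by metis
  \<comment> \<open>\<open>c'\<close> is played before the reply is known. The reply is the second
    entry of the history; it selects the strategy that continues on the tail.\<close>
  define \<sigma> where "\<sigma> xs = (if xs = [] then c else if tl xs = [] then c'
    else \<tau> (hd (tl xs)) (tl xs))" for xs
  have "wins_from \<G> k t c r \<sigma>"
    unfolding wins_from_def
  proof (intro conjI allI impI; (elim conjE)?)
    show "\<sigma> [] = c" by (simp add: \<sigma>_def)
  next
    fix \<rho> assume \<rho>0: "\<rho> 0 = r"
      and \<rho>: "\<forall>s. \<rho> (Suc s) \<in> closed_nbhd (snapshot \<G> (t + s)) (\<rho> s)"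
    have N: "\<rho> 1 \<in> ?N" using \<rho>[rule_format, of 0] \<rho>0 by simp
    define \<rho>' where "\<rho>' s = \<rho> (Suc s)" for s
    have nil: "\<tau> (\<rho> 1) [] = c'" using \<tau>[OF N] by (simp add: wins_from_def)
    have \<rho>'play: "\<rho>' 0 = \<rho> 1 \<and> (\<forall>s. \<rho>' (Suc s) \<in> closed_nbhd (snapshot \<G> (Suc t + s)) (\<rho>' s))"
      using \<rho> by (simp add: \<rho>'_def) (metis add_Suc_right)
    have shift: "map \<rho> [0..<Suc s] = \<rho> 0 # map \<rho>' [0..<s]" for s
      unfolding \<rho>'_def by (rule map_upt_Suc)
    have \<sigma>_shift: "\<sigma> (map \<rho> [0..<Suc s]) = \<tau> (\<rho> 1) (map \<rho>' [0..<s])" for s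
    proof (cases s)
      case 0
      then show ?thesis using nil by (simp add: \<sigma>_def)
    next
      case (Suc s')
      have "hd (map \<rho>' [0..<s]) = \<rho> 1" by (simp add: Suc \<rho>'_def hd_map del: upt_Suc)
      then show ?thesis unfolding shift \<sigma>_def using Suc by simp
    qed
    from \<tau>[OF N] \<rho>'play
    have legal: "\<forall>s. \<forall>i<k. \<tau> (\<rho> 1) (map \<rho>' [0..<Suc s]) i
             \<in> closed_nbhd (snapshot \<G> (Suc t + s)) (\<tau> (\<rho> 1) (map \<rho>' [0..<s]) i)"
      and win: "\<exists>s. \<exists>i<k. \<tau> (\<rho> 1) (map \<rho>' [0..<Suc s]) i = \<rho>' s"
      unfolding wins_from_def by blast+
    show "\<sigma> (map \<rho> [0..<Suc s]) i \<in> closed_nbhd (snapshot \<G> (t + s)) (\<sigma> (map \<rho> [0..<s]) i)"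
      if "i < k" for s i
    proof (cases s)
      case 0
      have "\<sigma> (map \<rho> [0..<0]) = c" by (simp add: \<sigma>_def)
      moreover have "\<sigma> (map \<rho> [0..<Suc 0]) = c'" using \<sigma>_shift[of 0] nil by simp
      ultimately show ?thesis using move.hyps(1)[OF that] by (simp only: 0 add_0_right)
    next
      case (Suc s')
      show ?thesis using legal that unfolding Suc \<sigma>_shift by simp
    qed
    show "\<exists>s. \<exists>i<k. \<sigma> (map \<rho> [0..<Suc s]) i = \<rho> s"
      using win unfolding \<sigma>_shift[symmetric] \<rho>'_def by blast
  qed
  then show ?case by (intro exI)
qed

text \<open>All starts of the robber face the same placement \<open>c\<close>, so the strategies for
  single starts agree on the empty history, and the head of a longer history selects among
  them.\<close>

lemma winning_cop_strategyI:
  assumes c: "\<And>i. i < k \<Longrightarrow> c i \<in> pverts (footprint \<G>)"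
    and win: "\<And>r. r \<in> pverts (footprint \<G>) \<Longrightarrow> cops_win \<G> k 0 c r"
  shows "\<exists>\<sigma>. winning_cop_strategy \<G> k \<sigma>"
proof -
  have "\<forall>r \<in> pverts (footprint \<G>). \<exists>\<sigma>. wins_from \<G> k 0 c r \<sigma>"
    by (intro ballI cops_win_imp_wins_from win)
  from bchoice[OF this]
  obtain \<tau> where \<tau>: "\<And>r. r \<in> pverts (footprint \<G>) \<Longrightarrow> wins_from \<G> k 0 c r (\<tau> r)"
    by blast
  define \<sigma> where "\<sigma> xs = (if xs = [] then c else \<tau> (hd xs) xs)" for xs
  have nil: "\<sigma> [] = c" by (simp add: \<sigma>_def)
  have "(\<forall>t. \<forall>i<k. \<sigma> (map \<rho> [0..<Suc t]) i \<in> closed_nbhd (snapshot \<G> t) (\<sigma> (map \<rho> [0..<t]) i))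
      \<and> (\<exists>t. \<exists>i<k. \<sigma> (map \<rho> [0..<Suc t]) i = \<rho> t)"
    if \<rho>: "robber_play \<G> \<rho>" for \<rho>
  proof -
    have w: "wins_from \<G> k 0 c (\<rho> 0) (\<tau> (\<rho> 0))"
      using \<tau> \<rho> by (simp add: robber_play_def)
    have "\<sigma> (map \<rho> [0..<t]) = \<tau> (\<rho> 0) (map \<rho> [0..<t])" for t
    proof (cases t)
      case 0
      then show ?thesis using w by (simp add: \<sigma>_def wins_from_def)
    next
      case (Suc t')
      then show ?thesis by (simp add: \<sigma>_def hd_map del: upt_Suc)
    qed
    then show ?thesis using w \<rho> unfolding wins_from_def robber_play_def by (simp del: upt_Suc)
  qed
  then have "winning_cop_strategy \<G> k \<sigma>"
    using c nil by (auto simp: winning_cop_strategy_def cop_strategy_def)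
  then show ?thesis by (intro exI)
qed

section \<open>Moving cops while others guard\<close>

lemma footprint_arc_recurs:
  assumes "\<G> \<noteq> []" and "e \<in> parcs (footprint \<G>)"
  shows "\<exists>s\<ge>t. e \<in> parcs (snapshot \<G> s)"
proof -
  from assms(2) obtain j where j: "j < length \<G>" "e \<in> parcs (\<G> ! j)"
    by (auto simp: footprint_def in_set_conv_nth)
  \<comment> \<open>Going on from \<open>j\<close> by \<open>t\<close> whole periods keeps the
    snapshot and, the period being positive, reaches at least round \<open>t\<close>.\<close>
  have "(j + length \<G> * t) mod length \<G> = j" using j(1) by simp
  moreover have "t \<le> j + length \<G> * t" using assms(1)
    by (cases "length \<G>") auto
  ultimately show ?thesis using j(2) unfolding snapshot_def by metis
qed

lemma closed_nbhd_snapshot_subset: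
  assumes "\<G> \<noteq> []"
  shows "closed_nbhd (snapshot \<G> t) v \<subseteq> closed_nbhd (footprint \<G>) v"
proof -
  have "\<G> ! (t mod length \<G>) \<in> set \<G>" using assms by simp
  then show ?thesis by (fastforce simp: closed_nbhd_def snapshot_def footprint_def)
qed

lemma connected_rtrancl:
  assumes "connected H" and "arcs_ends H \<subseteq> E" and "sym E"
    and "u \<in> verts H" and "v \<in> verts H"
  shows "(u, v) \<in> E\<^sup>*"
proof -
  have "symcl (arcs_ends H) \<subseteq> E" using assms(2,3) by (auto simp: symcl_def dest: symD)
  moreover have "(u, v) \<in> rtrancl_on (verts H) (symcl (arcs_ends H))"
    using assms(1,4,5) by (simp add: connected_conv)
  ultimately show ?thesis by (meson rtrancl_mono rtrancl_on_rtranclI subsetD)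
qed

text \<open>\<open>R\<close> is the territory of the robber and \<open>D\<close> is to be occupied
  by guards: he can leave \<open>R\<close> only from a vertex of \<open>D\<close>, where a guard
  already has him.\<close>

locale guarded_territory =
  fixes \<G> :: "'a pair_pre_digraph list" and k :: nat and D R :: "'a set"
  assumes periodic: "periodic_graph \<G>"
    and leave_only_through_guards: "\<And>r. r \<in> R - D \<Longrightarrow> closed_nbhd (footprint \<G>) r \<subseteq> R"
begin

lemma nonempty: "\<G> \<noteq> []"
  using periodic by (simp add: periodic_graph_def)

lemma footprint_reachable:
  assumes "u \<in> pverts (footprint \<G>)" and "v \<in> pverts (footprint \<G>)"
  shows "(u, v) \<in> (parcs (footprint \<G>))\<^sup>*"
proof (rule connected_rtrancl)
  show "connected (with_proj (footprint \<G>))"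
    using periodic by (simp add: periodic_graph_def)
  show "sym (parcs (footprint \<G>))"
  proof (rule symI)
    fix a b assume "(a, b) \<in> parcs (footprint \<G>)"
    then obtain G where G: "G \<in> set \<G>" "(a, b) \<in> parcs G" by (auto simp: footprint_def)
    then interpret refl_graph G using periodic by (simp add: periodic_graph_def)
    show "(b, a) \<in> parcs (footprint \<G>)"
      using G arcs_symmetric by (auto simp: footprint_def)
  qed
qed (use assms in auto)

text \<open>A robber on \<open>D\<close> stands on a cop, and any other reply stays in
  \<open>R\<close>. So it suffices that the new placement wins against every position in
  \<open>R\<close>.\<close>

lemma cops_win_guarded_step:
  assumes "D \<subseteq> c ` {..<k}"
    and "\<And>i. i < k \<Longrightarrow> c' i \<in> closed_nbhd (snapshot \<G> t) (c i)"
    and "\<And>r. r \<in> R \<Longrightarrow> cops_win \<G> k (Suc t) c' r"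
    and "r \<in> R"
  shows "cops_win \<G> k t c r"
proof (cases "r \<in> D")
  case True
  with assms(1) show ?thesis by (auto intro: capture)
next
  case False
  with assms(4) leave_only_through_guards closed_nbhd_snapshot_subset[OF nonempty]
  have "closed_nbhd (snapshot \<G> t) r \<subseteq> R" by blast
  with assms(2,3) show ?thesis by (blast intro: move)
qed

text \<open>The cops wait for a round that has the arc. Neither this round nor the robber's position
  by then can be controlled, hence \<open>win\<close> for all \<open>t\<close> and all
  \<open>r\<close> in \<open>R\<close>.\<close>

lemma cops_win_move_along_arc:
  assumes D: "D \<subseteq> c ` {..<k}"
    and arc: "(c i, v) \<in> parcs (footprint \<G>)"
    and win: "\<And>t r. r \<in> R \<Longrightarrow> cops_win \<G> k t (c(i := v)) r"
    and r: "r \<in> R"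
  shows "cops_win \<G> k t c r"
proof -
  obtain s where s: "t \<le> s" "(c i, v) \<in> parcs (snapshot \<G> s)"
    using footprint_arc_recurs[OF nonempty arc] by blast
  \<comment> \<open>Backward induction from round \<open>s\<close>, in which the arc is used; in the
    rounds before it all cops stand still.\<close>
  from s(1) r show ?thesis
  proof (induction t arbitrary: r rule: inc_induct)
    case base
    show ?case
      by (rule cops_win_guarded_step[OF D _ win base]) (use s(2) in \<open>auto simp: closed_nbhd_def\<close>)
  next
    case (step t)
    show ?case
      by (rule cops_win_guarded_step[OF D _ step.IH step.prems]) (auto simp: closed_nbhd_def)
  qed
qed

text \<open>Cop \<open>i\<close> follows a path arc by arc. As it is not in \<open>I\<close>, the
  cops of \<open>I\<close> cover \<open>D\<close> all the time.\<close>

lemma cops_win_move_one: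
  assumes "(u, v) \<in> (parcs (footprint \<G>))\<^sup>*" and "c i = u" and "i \<notin> I" and "I \<subseteq> {..<k}"
    and "D \<subseteq> c ` I"
    and "\<And>t r. r \<in> R \<Longrightarrow> cops_win \<G> k t (c(i := v)) r"
    and "r \<in> R"
  shows "cops_win \<G> k t c r"
  using assms
proof (induction arbitrary: c t r rule: converse_rtrancl_induct)
  case base
  then show ?case by (metis fun_upd_triv)
next
  case (step u w)
  have "D \<subseteq> c ` {..<k}" using step.prems(3,4) by blast
  moreover have "(c i, w) \<in> parcs (footprint \<G>)" using step by simp
  moreover have "cops_win \<G> k t (c(i := w)) r" if "r \<in> R" for t r
  proof (rule step.IH)
    have "(c(i := w)) ` I = c ` I" using step.prems(2) by (intro image_cong) auto
    then show "D \<subseteq> (c(i := w)) ` I" using step.prems(4) by simp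
  next
    show "cops_win \<G> k t ((c(i := w))(i := v)) r" if "r \<in> R" for t r
      unfolding fun_upd_upd by (rule step.prems(5)[OF that])
  qed (use step.prems(2,3) that in auto)
  ultimately show ?case using step.prems(6) by (rule cops_win_move_along_arc)
qed

lemma cops_win_relocate:
  assumes "finite J" and "J \<inter> I = {}" and "I \<subseteq> {..<k}" and "D \<subseteq> c ` I"
    and "\<And>i. i \<in> J \<Longrightarrow> c i \<in> pverts (footprint \<G>)"
    and "\<And>i. i \<in> J \<Longrightarrow> c' i \<in> pverts (footprint \<G>)"
    and "\<And>i. i \<notin> J \<Longrightarrow> c' i = c i"
    and "\<And>t r. r \<in> R \<Longrightarrow> cops_win \<G> k t c' r"
    and "r \<in> R"
  shows "cops_win \<G> k t c r"
  using assms
proof (induction arbitrary: c t r rule: finite_induct)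
  case empty
  then have "c' = c" by auto
  with empty show ?case by simp
next
  case (insert j J)
  \<comment> \<open>Cop \<open>j\<close> travels first. Afterwards the placement agrees with
    \<open>c'\<close> outside \<open>J\<close>, as the induction hypothesis demands.\<close>
  have "cops_win \<G> k t (c(j := c' j)) r" if "r \<in> R" for t r
  proof (rule insert.IH)
    have "(c(j := c' j)) ` I = c ` I" using insert.prems(1) by (intro image_cong) auto
    then show "D \<subseteq> (c(j := c' j)) ` I" using insert.prems(3) by simp
  next
    show "cops_win \<G> k t c' r" if "r \<in> R" for t r
      using that by (rule insert.prems(7))
  qed (use insert.prems(1,2,4-6) insert.hyps(2) that in auto)
  moreover have "(c j, c' j) \<in> (parcs (footprint \<G>))\<^sup>*"
    using insert.prems by (intro footprint_reachable) auto
  ultimately show ?case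
    using insert.prems(1-3,8) by (intro cops_win_move_one[of "c j" "c' j" c j I]) auto
qed

end

section \<open>Branches of trees\<close>

text \<open>For an arc from \<open>x\<close> to \<open>y\<close> of a tree, this is the component of
  \<open>y\<close> after deletion of \<open>x\<close>. Barring arcs into \<open>x\<close> is enough,
  because walks start at \<open>y\<close>.\<close>

definition branch :: "'b rel \<Rightarrow> 'b \<Rightarrow> 'b \<Rightarrow> 'b set" where
  "branch E x y = (E \<inter> UNIV \<times> - {x})\<^sup>* `` {y}"

lemma root_in_branch: "y \<in> branch E x y"
  by (simp add: branch_def)

lemma branch_step: "a \<in> branch E x y \<Longrightarrow> (a, b) \<in> E \<Longrightarrow> b \<noteq> x \<Longrightarrow> b \<in> branch E x y"
  unfolding branch_def Image_singleton_iff by (erule rtrancl_into_rtrancl) simp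

text \<open>Take \<open>z\<close> right after the last visit of the walk to \<open>y\<close>.
  Keeping the arc to \<open>z\<close> in the smaller relation \<open>F\<close> allows the conclusion
  that \<open>z\<close> is not a vertex barred in \<open>F\<close>.\<close>

lemma rtrancl_decompose_branch:
  assumes "(y, a) \<in> F\<^sup>*" and "F \<subseteq> E" and "a \<noteq> y"
  shows "\<exists>z. (y, z) \<in> F \<and> a \<in> branch E y z"
  using assms
proof (induction rule: rtrancl_induct)
  case base
  then show ?case by simp
next
  case (step a b)
  show ?case
  proof (cases "a = y")
    case True
    with step show ?thesis by (auto intro: root_in_branch)
  next
    case False
    with step show ?thesis by (blast intro: branch_step)
  qed
qed

lemma branch_subset_pverts:
  assumes "pair_wf_digraph T" and "y \<in> pverts T"
  shows "branch (parcs T) x y \<subseteq> pverts T"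
proof -
  interpret pair_wf_digraph T by fact
  have "a \<in> pverts T" if "(y, a) \<in> (parcs T \<inter> UNIV \<times> - {x})\<^sup>*" for a
    using that assms(2) by induction (auto dest: in_arcsD2)
  then show ?thesis by (auto simp: branch_def)
qed

text \<open>A path from \<open>y\<close> to \<open>a\<close> that avoids \<open>x\<close> closes up to a cycle through \<open>x\<close>, which has length
  at least three unless \<open>a = y\<close>.\<close>

lemma tree_branch_unique_attachment:
  assumes T: "is_tree T" and xy: "(x, y) \<in> parcs T" and a: "a \<in> branch (parcs T) x y"
    and ax: "(a, x) \<in> parcs T"
  shows "a = y"
proof (rule ccontr)
  assume ne: "a \<noteq> y"
  interpret pair_graph T using T by (simp add: is_tree_def)
  have "x \<noteq> y" using xy no_loops' by auto
  have "\<exists>p. awalk y p a \<and> x \<notin> set (pawalk_verts y p)"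
    if "(y, a) \<in> (parcs T \<inter> UNIV \<times> - {x})\<^sup>*" for a
    using that
  proof induction
    case base
    have "awalk y [] y" using xy by (auto simp: awalk_Nil_iff dest: in_arcsD2)
    then show ?case using \<open>x \<noteq> y\<close> by (intro exI[of _ "[]"]) simp
  next
    case (step a b)
    then obtain p where p: "awalk y p a" "x \<notin> set (pawalk_verts y p)" by blast
    have ab: "awalk a [(a, b)] b" using step(2) by (auto simp: awalk_simps dest: in_arcsD2)
    then have "awalk y (p @ [(a, b)]) b" using p(1) by simp
    moreover from this have "set (pawalk_verts y (p @ [(a, b)]))
        = set (pawalk_verts y p) \<union> set (pawalk_verts a [(a, b)])"
      using p(1) ab by (intro set_awalk_verts_append)
    ultimately show ?case using p step(2) by (intro exI[of _ "p @ [(a, b)]"]) auto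
  qed
  then obtain p where p: "awalk y p a" "x \<notin> set (pawalk_verts y p)"
    using a by (auto simp: branch_def)
  \<comment> \<open>A cycle may not repeat vertices, so the walk is shortened to a path; its arcs
    are among those of \<open>p\<close>, so it still avoids \<open>x\<close>.\<close>
  define q where "q = awalk_to_apath p"
  have q1: "apath y q a" "set q \<subseteq> set p"
    unfolding q_def using p(1) by (rule apath_awalk_to_apath, rule awalk_to_apath_subset)
  have yqa: "awalk y q a" using q1(1) by (simp add: apath_def)
  have "set (pawalk_verts y q) \<subseteq> set (pawalk_verts y p)"
    unfolding set_awalk_verts[OF yqa] set_awalk_verts[OF p(1)] using q1(2) by auto
  with p(2) have "x \<notin> set (pawalk_verts y q)" by blast
  note q = q1(1) this
  let ?p = "(x, y) # q @ [(a, x)]"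
  have x: "x \<in> pverts T" using xy in_arcsD1 by blast
  have ax': "awalk a [(a, x)] x" using ax x by (simp add: awalk_simps)
  have "awalk y (q @ [(a, x)]) x" using yqa ax' by simp
  moreover have "pawalk_verts y (q @ [(a, x)]) = pawalk_verts y q @ [x]"
    using awalk_verts_append[OF \<open>awalk y (q @ [(a, x)]) x\<close>] yqa by simp
  ultimately have "awalk x ?p x" "distinct (tl (pawalk_verts x ?p))"
    using xy q by (simp_all add: awalk_Cons_iff apath_def)
  then have "cycle ?p" unfolding cycle_def by blast
  moreover have "\<forall>p. cycle p \<longrightarrow> length p < 3" using T by (simp add: is_tree_def)
  ultimately have "length ?p < 3" by blast
  then have "q = []" by simp
  then show False using yqa ne by (simp add: awalk_Nil_iff)
qed

text \<open>If \<open>x\<close> lay in the branch at \<open>y\<close> through \<open>z\<close>, it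
  would be a second attachment to \<open>y\<close> besides \<open>z\<close>. So walks in that branch
  avoid \<open>x\<close>; and \<open>y\<close> lies only in the larger branch.\<close>

lemma tree_branch_psubset:
  assumes T: "is_tree T" and xy: "(x, y) \<in> parcs T" and yz: "(y, z) \<in> parcs T" and "z \<noteq> x"
  shows "branch (parcs T) y z \<subset> branch (parcs T) x y"
proof -
  interpret pair_graph T using T by (simp add: is_tree_def)
  have x: "x \<notin> branch (parcs T) y z"
    using tree_branch_unique_attachment[OF T yz _ xy] \<open>z \<noteq> x\<close> by blast
  have "a \<in> branch (parcs T) x y" if "(z, a) \<in> (parcs T \<inter> UNIV \<times> - {y})\<^sup>*" for a
    using that
  proof induction
    case base
    show ?case using branch_step[OF root_in_branch yz \<open>z \<noteq> x\<close>] .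
  next
    case (step a b)
    have "b \<in> branch (parcs T) y z"
      using step(1,2) by (auto simp: branch_def intro: rtrancl_into_rtrancl)
    with x have "b \<noteq> x" by blast
    with step show ?case by (auto intro: branch_step)
  qed
  then have "branch (parcs T) y z \<subseteq> branch (parcs T) x y" by (auto simp: branch_def)
  moreover have "y \<notin> branch (parcs T) y z"
  proof
    assume "y \<in> branch (parcs T) y z"
    then have "(z, y) \<in> (parcs T \<inter> UNIV \<times> - {y})\<^sup>*" by (simp add: branch_def)
    then show False using yz no_loops' by (cases rule: rtranclE) auto
  qed
  ultimately show ?thesis using root_in_branch[of y "parcs T" x] by blast
qed

section \<open>Separation by adjacent bags\<close>

text \<open>The nodes whose bags contain \<open>v\<close> are connected, so some walk among them
  leads from \<open>a\<close> out of the branch. It can leave only by the arc from \<open>y\<close>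
  to \<open>x\<close>.\<close>

lemma tree_decomposition_adhesion:
  assumes td: "tree_decomposition G T B" and xy: "(x, y) \<in> parcs T"
    and a: "a \<in> branch (parcs T) x y" and b: "b \<in> pverts T" "b \<notin> branch (parcs T) x y"
    and v: "v \<in> B a" "v \<in> B b"
  shows "v \<in> B x \<inter> B y"
proof -
  have T: "is_tree T" using td by (simp add: tree_decomposition_def)
  interpret pair_graph T using T by (simp add: is_tree_def)
  let ?X = "{x \<in> pverts T. v \<in> B x}"
  let ?E = "parcs T \<inter> ?X \<times> ?X"
  have aT: "a \<in> pverts T"
    using branch_subset_pverts[of T y x] xy a in_arcsD2 by blast
  have "v \<in> pverts G" using td b v by (auto simp: tree_decomposition_def)
  then have "connected (with_proj T \<restriction> ?X)" using td by (simp add: tree_decomposition_def)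
  then have "(a, b) \<in> ?E\<^sup>*"
    by (rule connected_rtrancl)
      (use aT b v in \<open>auto simp: arcs_ends_conv intro!: symI arcs_symmetric\<close>)
  \<comment> \<open>The second disjunct does not depend on \<open>b\<close>, so it persists once the
    walk has left the branch, even if the walk returns.\<close>
  then have "b \<in> branch (parcs T) x y \<or> v \<in> B x \<inter> B y"
  proof induction
    case base
    then show ?case using a by simp
  next
    case (step b c)
    show ?case
    proof (cases "b \<in> branch (parcs T) x y \<and> c = x")
      case True
      with step(2) have "b = y"
        using tree_branch_unique_attachment[OF T xy, of b] by auto
      with True step(2) show ?thesis by auto
    next
      case False
      with step show ?thesis by (blast intro: branch_step)
    qed
  qed
  with b show ?thesis by blast
qed

text \<open>A bag containing both ends of an arc at \<open>r\<close> must belong to the branch,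
  since otherwise \<open>r\<close> would lie in the adhesion
  \<open>B x \<inter> B y\<close>.\<close>

lemma tree_decomposition_separation:
  assumes td: "tree_decomposition G T B" and xy: "(x, y) \<in> parcs T"
    and r: "r \<in> (\<Union>a \<in> branch (parcs T) x y. B a) - B x \<inter> B y"
  shows "closed_nbhd G r \<subseteq> (\<Union>a \<in> branch (parcs T) x y. B a)"
proof
  fix w assume "w \<in> closed_nbhd G r"
  then consider "w = r" | "(r, w) \<in> parcs G" by (auto simp: closed_nbhd_def)
  then show "w \<in> (\<Union>a \<in> branch (parcs T) x y. B a)"
  proof cases
    case 1
    with r show ?thesis by simp
  next
    case 2
    with td obtain b where b: "b \<in> pverts T" "r \<in> B b" "w \<in> B b"
      by (fastforce simp: tree_decomposition_def)
    then show ?thesis using tree_decomposition_adhesion[OF td xy _ b(1)] r by blast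
  qed
qed

section \<open>The strategy along the tree decomposition\<close>

text \<open>One guard is kept for each vertex of \<open>D\<close>; these form \<open>I\<close>. At
  least \<open>card (Y - D)\<close> cops remain, and \<open>J\<close> consists of that many, matched
  bijectively with \<open>Y - D\<close>. All others stay.\<close>

lemma exists_relocation:
  assumes "finite Y" and "card Y \<le> k" and "D \<subseteq> Y" and "D \<subseteq> c ` {..<k}"
  obtains J I c' where "finite J" "J \<inter> I = {}" "I \<subseteq> {..<k}" "J \<subseteq> {..<k}" "D \<subseteq> c ` I"
    "\<And>i. i \<in> J \<Longrightarrow> c' i \<in> Y" "\<And>i. i \<notin> J \<Longrightarrow> c' i = c i" "Y \<subseteq> c' ` {..<k}"
proof -
  obtain I where I: "I \<subseteq> {..<k}" "inj_on c I" "c ` I = D"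
    using assms(4) by (metis subset_image_inj)
  have finD: "finite D" and finI: "finite I"
    using assms finite_subset I(1) by blast+
  have "card (Y - D) \<le> card ({..<k} - I)"
    using assms I finD finI card_image[OF I(2)]
    by (simp add: card_Diff_subset)
  then obtain J where J: "J \<subseteq> {..<k} - I" "card J = card (Y - D)"
    by (meson obtain_subset_with_card_n)
  have finJ: "finite J" using J(1) finite_subset by blast
  obtain g where g: "bij_betw g J (Y - D)"
    using finite_same_card_bij[OF finJ _ J(2)] assms(1) by blast
  define c' where "c' i = (if i \<in> J then g i else c i)" for i
  have "c' ` J = Y - D" using g by (auto simp: c'_def bij_betw_def)
  moreover have "c' ` I = D"
  proof -
    have "c' ` I = c ` I" using J(1) by (intro image_cong) (auto simp: c'_def)
    with I(3) show ?thesis by simp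
  qed
  ultimately have "Y \<subseteq> c' ` (I \<union> J)" by blast
  also have "\<dots> \<subseteq> c' ` {..<k}" using I(1) J(1) by blast
  finally show thesis
  proof (rule that[of J I c', rotated -1])
    show "c' i \<in> Y" if "i \<in> J" for i
      using g that by (auto simp: c'_def bij_betw_def)
    show "c' i = c i" if "i \<notin> J" for i
      using that by (simp add: c'_def)
  qed (use finJ I J(1) in auto)
qed

text \<open>Induction on the size of the branch: once \<open>B y\<close> is occupied, the robber is
  caught or confined to a smaller branch at \<open>y\<close>.\<close>

lemma cops_win_branch:
  assumes per: "periodic_graph \<G>" and fin: "finite (pverts (footprint \<G>))"
    and td: "tree_decomposition (footprint \<G>) T B"
    and card: "\<And>x. x \<in> pverts T \<Longrightarrow> card (B x) \<le> k"
    and "(x, y) \<in> parcs T"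
    and "B x \<subseteq> c ` {..<k}" and "\<And>i. i < k \<Longrightarrow> c i \<in> pverts (footprint \<G>)"
    and "r \<in> (\<Union>a \<in> branch (parcs T) x y. B a)"
  shows "cops_win \<G> k t c r"
  using assms(5-)
proof (induction "card (branch (parcs T) x y)" arbitrary: x y c r t rule: less_induct)
  case less
  have T: "is_tree T" using td by (simp add: tree_decomposition_def)
  interpret T: pair_graph T using T by (simp add: is_tree_def)
  let ?D = "B x \<inter> B y" and ?R = "\<Union>a \<in> branch (parcs T) x y. B a"
  interpret guarded_territory \<G> k ?D ?R
    using per tree_decomposition_separation[OF td less.prems(1)] by unfold_locales
  have y: "y \<in> pverts T" using less.prems(1) T.in_arcsD2 by blast
  have By: "B y \<subseteq> pverts (footprint \<G>)" using td y by (auto simp: tree_decomposition_def)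
  have finite_branch: "finite (branch (parcs T) x y)"
    using branch_subset_pverts[OF T.pair_wf_digraph y] T.pair_finite_verts finite_subset by blast
  have finite_By: "finite (B y)" using By fin finite_subset by blast
  have D: "?D \<subseteq> B y" "?D \<subseteq> c ` {..<k}" using less.prems(2) by blast+
  obtain J I c' where *: "finite J" "J \<inter> I = {}" "I \<subseteq> {..<k}" "J \<subseteq> {..<k}" "?D \<subseteq> c ` I"
    "\<And>i. i \<in> J \<Longrightarrow> c' i \<in> B y" "\<And>i. i \<notin> J \<Longrightarrow> c' i = c i" "B y \<subseteq> c' ` {..<k}"
    using that by (rule exists_relocation[OF finite_By card[OF y] D])
  have c': "c' i \<in> pverts (footprint \<G>)" if "i < k" for i
    using *(6,7) By less.prems(3)[OF that] by (cases "i \<in> J") auto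
  have "cops_win \<G> k t c' r" if r: "r \<in> ?R" for t r
  proof (cases "r \<in> B y")
    case True
    with *(8) show ?thesis by (auto intro: capture)
  next
    case False
    from r obtain a where a: "a \<in> branch (parcs T) x y" "r \<in> B a" by blast
    with False have "a \<noteq> y" by blast
    \<comment> \<open>The walk from \<open>y\<close> to \<open>a\<close> inside the branch never
      enters \<open>x\<close>, so the next branch does not lead back through
      \<open>x\<close>.\<close>
    with a(1) obtain z where z: "(y, z) \<in> parcs T" "z \<noteq> x" "a \<in> branch (parcs T) y z"
      using rtrancl_decompose_branch[of y a "parcs T \<inter> UNIV \<times> - {x}" "parcs T"]
      by (auto simp: branch_def)
    have "card (branch (parcs T) y z) < card (branch (parcs T) x y)"
      using finite_branch tree_branch_psubset[OF T less.prems(1) z(1,2)]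
      by (rule psubset_card_mono)
    then show ?thesis
      using z(1) *(8) c' by (rule less.hyps) (use z(3) a(2) in auto)
  qed
  then show ?case
    using *(1,2,3,5) less.prems(3,4) *(4,6,7) By
    by (intro cops_win_relocate[of J I c c']) auto
qed

lemma tree_decomposition_imp_winning_cop_strategy:
  assumes per: "periodic_graph \<G>" and fin: "finite (pverts (footprint \<G>))"
    and td: "tree_decomposition (footprint \<G>) T B"
    and card: "\<And>x. x \<in> pverts T \<Longrightarrow> card (B x) \<le> k"
  shows "\<exists>\<sigma>. winning_cop_strategy \<G> k \<sigma>"
proof -
  let ?V = "pverts (footprint \<G>)"
  have T: "is_tree T" using td by (simp add: tree_decomposition_def)
  interpret T: pair_graph T using T by (simp add: is_tree_def)
  have conn: "connected (with_proj T)" using T by (simp add: is_tree_def)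
  then obtain x where x: "x \<in> pverts T" by (auto simp: connected_conv)
  have Bx: "B x \<subseteq> ?V" using td x by (auto simp: tree_decomposition_def)
  have "connected (with_proj (footprint \<G>))" using per by (simp add: periodic_graph_def)
  then obtain v where v: "v \<in> ?V" by (auto simp: connected_conv)
  have finite_Bx: "finite (B x)" using Bx fin finite_subset by blast
  \<comment> \<open>The relocation lemma with no guards, applied to all cops on \<open>v\<close>,
    yields the initial placement; surplus cops remain on the vertex \<open>v\<close>, so it is
    legal.\<close>
  obtain J I c where *: "finite J" "J \<inter> I = {}" "I \<subseteq> {..<k}" "J \<subseteq> {..<k}" "{} \<subseteq> (\<lambda>_. v) ` I"
    "\<And>i. i \<in> J \<Longrightarrow> c i \<in> B x" "\<And>i. i \<notin> J \<Longrightarrow> c i = v" "B x \<subseteq> c ` {..<k}"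
    using that
    by (rule exists_relocation[OF finite_Bx card[OF x] empty_subsetI empty_subsetI, of "\<lambda>_. v"])
  have c: "c i \<in> ?V" for i
    using *(6,7) Bx v by (cases "i \<in> J") auto
  have "cops_win \<G> k 0 c r" if "r \<in> ?V" for r
  proof -
    have "(\<Union>x \<in> pverts T. B x) = ?V" using td by (simp add: tree_decomposition_def)
    with that obtain a where a: "a \<in> pverts T" "r \<in> B a" by blast
    show ?thesis
    proof (cases "a = x")
      case True
      with a(2) *(8) show ?thesis by (auto intro: capture)
    next
      case False
      have "(x, a) \<in> (parcs T)\<^sup>*"
        using conn x a(1) by (intro connected_rtrancl) (auto intro: symI T.arcs_symmetric)
      from rtrancl_decompose_branch[OF this subset_refl False]
      obtain z where z: "(x, z) \<in> parcs T" "a \<in> branch (parcs T) x z" by blast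
      then have "r \<in> (\<Union>a \<in> branch (parcs T) x z. B a)" using a(2) by blast
      then show ?thesis
        by (intro cops_win_branch[OF per fin td _ z(1) *(8)] card c)
    qed
  qed
  with c show ?thesis by (intro winning_cop_strategyI)
qed

text \<open>A single bag with all vertices shows that the minimum defining \<open>treewidth\<close>
  is attained.\<close>

lemma trivial_tree_decomposition:
  assumes "pair_wf_digraph G"
  shows "tree_decomposition G \<lparr>pverts = {x}, parcs = {}\<rparr> (\<lambda>_. pverts G)"
proof -
  interpret pair_wf_digraph G by fact
  let ?T = "\<lparr>pverts = {x}, parcs = {}\<rparr>"
  interpret T: pair_graph ?T by unfold_locales (auto simp: symmetric_def intro: symI)
  have "is_tree ?T"
    unfolding is_tree_def T.cycle_def
    by (auto simp: connected_conv T.awalk_def T.pair_graph)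
  moreover have "connected (with_proj ?T \<restriction> {y \<in> pverts ?T. v \<in> pverts G})" if "v \<in> pverts G" for v
    using that by (auto simp: connected_conv)
  ultimately show ?thesis
    by (auto simp: tree_decomposition_def dest: in_arcsD1 in_arcsD2)
qed

lemma treewidth_witness:
  assumes "pair_wf_digraph G"
  obtains T :: "nat pair_pre_digraph" and B where
    "tree_decomposition G T B" "\<And>x. x \<in> pverts T \<Longrightarrow> card (B x) \<le> treewidth G + 1"
proof -
  have "\<exists>(T :: nat pair_pre_digraph) B. tree_decomposition G T B \<and> treewidth G = width T B"
    unfolding treewidth_def
    by (rule LeastI_ex, intro exI conjI, rule trivial_tree_decomposition[OF assms], rule refl)
  then obtain T :: "nat pair_pre_digraph" and B
    where td: "tree_decomposition G T B" and w: "treewidth G = width T B" by blast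
  interpret T: pair_graph T using td by (simp add: tree_decomposition_def is_tree_def)
  have "card (B x) \<le> treewidth G + 1" if "x \<in> pverts T" for x
  proof -
    have "card (B x) \<le> (MAX x \<in> pverts T. card (B x))"
      using that T.pair_finite_verts by (intro Max_ge) auto
    \<comment> \<open>The subtraction in \<open>width\<close> truncates at 0, which is harmless:
      \<open>m \<le> (m - 1) + 1\<close> for every natural \<open>m\<close>.\<close>
    then show ?thesis by (simp add: w width_def)
  qed
  with td show thesis by (rule that)
qed

theorem theorem3:
  fixes G :: "'a pair_pre_digraph"
  assumes "refl_graph G"
  shows "c_max G \<le> enat (treewidth G + 1)"
proof -
  interpret refl_graph G by fact
  obtain T :: "nat pair_pre_digraph" and B where td: "tree_decomposition G T B"
    and card: "\<And>x. x \<in> pverts T \<Longrightarrow> card (B x) \<le> treewidth G + 1"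
    using treewidth_witness pair_wf_digraph_axioms by blast
  \<comment> \<open>One optimal decomposition of \<open>G\<close> serves every \<open>\<G>\<close>
    with this footprint.\<close>
  have "cop_number \<G> \<le> treewidth G + 1" if "periodic_graph \<G>" "footprint \<G> = G" for \<G>
    unfolding cop_number_def
    by (rule Least_le, rule tree_decomposition_imp_winning_cop_strategy)
      (use that td card pair_finite_verts in auto)
  then show ?thesis
    unfolding c_max_def by (intro SUP_least) auto
qed

end
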